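(* For $d\ge1$ let $M_d$ be the uncentered maximal operator on $(\mathbb{R}^d,\|\cdot\|_\infty)$ (associated to cubes with sides parallel to the axes), and let $\|M_d\|_{\operatorname{Op}(1)}$ be its norm on the Lipschitz functions $\operatorname{Lip}(\mathbb{R}^d,\|\cdot\|_\infty)$. Then $\|M_d\|_{\operatorname{Op}(1)}=\frac{d-1}{d+1}+o\!\left(\frac1{d+1}\right)$ as $d\to\infty$. More precisely, $$\frac{d-1}{d+1}<\|M_d\|_{\operatorname{Op}(1)}\le\frac{d}{d+1}-\frac1{d+1}\left(1-\frac1{\sqrt d}\right)\left[1-\left(1-\frac1{2\sqrt d-1}\right)^d\right].$$
   Context: On $\mathbb{R}^d$ with the norm $\|\cdot\|_\infty$, the uncentered Hardy-Littlewood maximal function of a locally integrable $f:\mathbb{R}^d\to\mathbb{R}$ is $M_df(x)=\sup_{B\ni x}\frac1{|B|}\int_B|f(y)|\,dy\in[0,\infty]$, the supremum being over all $\ell_\infty$ balls $B$ (of positive finite radius) containing $x$; $|B|$ is Lebesgue measure. For $f:\mathbb{R}^d\to\mathbb{R}$ let $\operatorname{Lip}(f)=\sup_{x\ne y}\frac{|f(x)-f(y)|}{\|x-y\|_\infty}$, and let $\operatorname{Lip}(\mathbb{R}^d,\|\cdot\|_\infty)$ be the set of $f$ with $\operatorname{Lip}(f)<\infty$. Then $$\|M_d\|_{\operatorname{Op}(1)}=\sup\Big\{\frac{\operatorname{Lip}(M_df)}{\operatorname{Lip}(f)}: 0<\operatorname{Lip}(f)<\infty\Big\}.$$ If $M_df\equiv\infty$,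 it is regarded as constant, i.e. $\operatorname{Lip}(M_df)=0$. *)

theory Defs
  imports "HOL-Analysis.Analysis" "HOL-Library.Landau_Symbols"
begin

text \<open>
  The dimension \<open>d\<close> has to vary inside the statement (asymptotics as \<open>d \<rightarrow> \<infinity>\<close>), so points of
  the \<open>d\<close>-dimensional space are extensional functions on the index set \<open>{..<d}\<close>, and functions on
  that space are functions on \<open>nat \<Rightarrow> real\<close> of which only the values on the carrier \<open>Rd d\<close> matter.
\<close>

definition Rd :: "nat \<Rightarrow> (nat \<Rightarrow> real) set" where
  "Rd d = {..<d} \<rightarrow>\<^sub>E UNIV"

definition leb :: "nat \<Rightarrow> (nat \<Rightarrow> real) measure" where
  "leb d = completion (\<Pi>\<^sub>M i\<in>{..<d}. lborel)"

text \<open>Intended for \<open>d \<ge> 1\<close> only (the maximum of the empty set is unspecified).\<close>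

definition norm_inf :: "nat \<Rightarrow> (nat \<Rightarrow> real) \<Rightarrow> real" where
  "norm_inf d x = Max ((\<lambda>i. \<bar>x i\<bar>) ` {..<d})"

definition dist_inf :: "nat \<Rightarrow> (nat \<Rightarrow> real) \<Rightarrow> (nat \<Rightarrow> real) \<Rightarrow> real" where
  "dist_inf d x y = norm_inf d (\<lambda>i. x i - y i)"

definition ball_inf :: "nat \<Rightarrow> (nat \<Rightarrow> real) \<Rightarrow> real \<Rightarrow> (nat \<Rightarrow> real) set" where
  "ball_inf d c r = {y \<in> Rd d. dist_inf d c y \<le> r}"

text \<open>Taking open instead of closed balls would give the same supremum for every locally
  integrable \<open>f\<close>: enlarge a closed ball slightly, and note that spheres are null sets.\<close>

definition maximal :: "nat \<Rightarrow> ((nat \<Rightarrow> real) \<Rightarrow> real) \<Rightarrow> (nat \<Rightarrow> real) \<Rightarrow> ennreal" where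
  "maximal d f x =
    (SUP B \<in> {ball_inf d c r | c r. c \<in> Rd d \<and> r > 0 \<and> x \<in> ball_inf d c r}.
      (\<integral>\<^sup>+y\<in>B. ennreal \<bar>f y\<bar> \<partial>leb d) / emeasure (leb d) B)"

text \<open>The Lipschitz constant is defined for extended-real-valued functions so that it applies to
  both \<open>f\<close> and its maximal function. As \<open>\<bar>\<infinity> - \<infinity>\<bar> = \<infinity>\<close> in \<open>ereal\<close>, equal values are treated
  separately; thus a function that is identically \<open>\<infinity>\<close> has constant \<open>0\<close>, and one that takes both
  finite and infinite values has constant \<open>\<infinity>\<close>.\<close>

definition Lip :: "nat \<Rightarrow> ((nat \<Rightarrow> real) \<Rightarrow> ereal) \<Rightarrow> ereal" where
  "Lip d g = (SUP (x, y) \<in> {(x, y). x \<in> Rd d \<and> y \<in> Rd d \<and> x \<noteq> y}.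
      (if g x = g y then 0 else \<bar>g x - g y\<bar>) / ereal (dist_inf d x y))"

definition op_norm_Lip :: "nat \<Rightarrow> ereal" where
  "op_norm_Lip d =
    (SUP f \<in> {f :: (nat \<Rightarrow> real) \<Rightarrow> real. 0 < Lip d (\<lambda>x. ereal (f x)) \<and> Lip d (\<lambda>x. ereal (f x)) < \<infinity>}.
      Lip d (\<lambda>x. enn2ereal (maximal d f x)) / Lip d (\<lambda>x. ereal (f x)))"

end

theory Submission
  imports Defs "HOL-Real_Asymp.Real_Asymp"
begin

text \<open>
  For the upper bound, let \<open>Q\<close> be a cube containing \<open>x\<close> and let \<open>h = \<parallel>x - y\<parallel>\<close>. Fix \<open>\<alpha> \<in> [0, 1]\<close> and, in
  each coordinate, stretch \<open>Q\<close> by \<open>h\<close> on the side towards \<open>y\<close> and by \<open>\<alpha> h\<close> on the other side. The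
  resulting cube contains \<open>y\<close>, and the affine map from \<open>Q\<close> onto it moves the points of \<open>Q\<close> by vectors
  that are, up to signs of coordinates, uniformly distributed in \<open>h [-\<alpha>, 1]\<^sup>d\<close>. Hence the average
  decreases by at most \<open>h Lip(f)\<close> times the mean of the norm over \<open>[-\<alpha>, 1]\<^sup>d\<close>, which is
  \<open>1 - (1 + \<alpha> - \<alpha> (2 \<alpha> / (1 + \<alpha>))\<^sup>d) / (d + 1)\<close>; take \<open>\<alpha> = 1 - 1 / sqrt d\<close>.

  For the lower bound, let \<open>f = max 0 (1 - \<parallel>x\<parallel>)\<close>. Its maximal function is at least \<open>1\<close> at the origin,
  while every average of \<open>f\<close> over a cube containing \<open>(1, ..., 1)\<close> is bounded by the maximum over \<open>\<alpha>\<close>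
  of its average over \<open>[-\<alpha>, 1]\<^sup>d\<close>, and that is strictly less than \<open>2 / (d + 1)\<close>.
\<close>

subsection \<open>Averages over cubes\<close>

text \<open>A cube is given by its lower corner and side length rather than by centre and radius,
  because stretching it unequally on its two sides then acts simply on \<open>a\<close> and
  \<open>L\<close>.\<close>

definition cube :: "nat \<Rightarrow> (nat \<Rightarrow> real) \<Rightarrow> real \<Rightarrow> (nat \<Rightarrow> real) set" where
  "cube d a L = (\<Pi>\<^sub>E i\<in>{..<d}. {a i..a i + L})"

definition cube_map :: "nat \<Rightarrow> (nat \<Rightarrow> real) \<Rightarrow> real \<Rightarrow> (nat \<Rightarrow> real) \<Rightarrow> nat \<Rightarrow> real" where
  "cube_map d a L u = (\<lambda>i\<in>{..<d}. a i + L * u i)"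

text \<open>The underlying space is all of \<open>Rd d\<close>; the measure is merely concentrated
  on the unit cube. Hence bounds that use \<open>0 \<le> u i \<le> 1\<close> are available only
  almost everywhere.\<close>

definition unit_cube :: "nat \<Rightarrow> (nat \<Rightarrow> real) measure" where
  "unit_cube d = (\<Pi>\<^sub>M i\<in>{..<d}. uniform_measure lborel {0..1})"

section \<open>The supremum norm and its balls\<close>

lemma norm_inf_le_iff: "d \<ge> 1 \<Longrightarrow> norm_inf d x \<le> t \<longleftrightarrow> (\<forall>i<d. \<bar>x i\<bar> \<le> t)"
  unfolding norm_inf_def by (subst Max_le_iff) (auto simp: lessThan_empty_iff)

lemma abs_le_norm_inf: "i < d \<Longrightarrow> \<bar>x i\<bar> \<le> norm_inf d x"
  unfolding norm_inf_def by (intro Max_ge) auto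

lemma norm_inf_nonneg: "d \<ge> 1 \<Longrightarrow> 0 \<le> norm_inf d x"
  using abs_le_norm_inf[of 0 d x] by simp

text \<open>Comparing absolute values of the differences makes this cover symmetry of the distance
  as well as changes outside the first \<open>d\<close> coordinates.\<close>

lemma dist_inf_cong: "(\<And>i. i < d \<Longrightarrow> \<bar>x i - y i\<bar> = \<bar>x' i - y' i\<bar>) \<Longrightarrow> dist_inf d x y = dist_inf d x' y'"
  unfolding dist_inf_def norm_inf_def by (intro arg_cong[where f = Max] image_cong) auto

lemma dist_inf_pos:
  assumes "x \<in> Rd d" "y \<in> Rd d" "x \<noteq> y"
  shows "0 < dist_inf d x y"
proof -
  obtain i where i: "i < d" "x i \<noteq> y i"
    using assms unfolding Rd_def by (metis PiE_ext lessThan_iff)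
  then show ?thesis
    using abs_le_norm_inf[OF i(1), of "\<lambda>i. x i - y i"] unfolding dist_inf_def by linarith
qed

lemma ball_inf_eq_cube:
  assumes "d \<ge> 1"
  shows "ball_inf d c r = cube d (\<lambda>i. c i - r) (2 * r)"
proof -
  have "\<bar>c i - y i\<bar> \<le> r \<longleftrightarrow> y i \<in> {c i - r..c i - r + 2 * r}" for y i
    by auto
  then show ?thesis
    using assms unfolding ball_inf_def cube_def Rd_def dist_inf_def
    by (simp only: norm_inf_le_iff set_eq_iff PiE_iff mem_Collect_eq) auto
qed

lemma cube_eq_ball_inf:
  assumes "d \<ge> 1"
  shows "cube d a L = ball_inf d (\<lambda>i\<in>{..<d}. a i + L / 2) (L / 2)"
  unfolding ball_inf_eq_cube[OF assms] cube_def by (intro PiE_cong) (simp add: field_simps)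

section \<open>Averages as integrals over the unit cube\<close>

text \<open>Substituting \<open>x = a + L * v\<close> produces a factor \<open>L\<close>, which
  cancels against the length of the interval.\<close>

lemma emeasure_uniform_lborel_affine:
  fixes a L :: real
  assumes L: "L > 0" and A[measurable]: "A \<in> sets borel"
  shows "emeasure (uniform_measure lborel {0..1}) {v. a + L * v \<in> A} =
    emeasure (uniform_measure lborel {a..a + L}) A"
proof -
  have m[measurable]: "{v. a + L * v \<in> A} \<in> sets borel"
    by measurable
  have "emeasure lborel ({a..a + L} \<inter> A) = (\<integral>\<^sup>+x. indicator ({a..a + L} \<inter> A) x \<partial>lborel)"
    by simp
  also have "\<dots> = ennreal L * (\<integral>\<^sup>+x. indicator ({a..a + L} \<inter> A) (a + L * x) \<partial>lborel)"
    using L by (subst nn_integral_real_affine[where t = a and c = L]) auto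
  also have "(\<integral>\<^sup>+x. indicator ({a..a + L} \<inter> A) (a + L * x) \<partial>lborel) =
      (\<integral>\<^sup>+x. indicator ({0..1} \<inter> {v. a + L * v \<in> A}) x \<partial>lborel)"
    using L by (intro nn_integral_cong) (auto simp: indicator_def mult_le_cancel_left1 zero_le_mult_iff)
  also have "\<dots> = emeasure lborel ({0..1} \<inter> {v. a + L * v \<in> A})"
    by simp
  finally have "emeasure lborel ({a..a + L} \<inter> A) / ennreal L =
      emeasure lborel ({0..1} \<inter> {v. a + L * v \<in> A})"
    using L by (subst (asm) mult.commute) (simp add: ennreal_mult_divide_eq)
  moreover have "z / 1 = z" for z :: ennreal
    by (simp add: divide_ennreal_def)
  ultimately show ?thesis
    using L m by (simp add: emeasure_uniform_measure)
qed

lemma product_sigma_finite_uniform: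
  fixes a L :: "nat \<Rightarrow> real"
  assumes "\<And>i. L i > 0"
  shows "product_sigma_finite (\<lambda>i. uniform_measure lborel {a i..a i + L i})"
proof (rule product_sigma_finite.intro)
  fix i
  have "finite_measure (uniform_measure lborel {a i..a i + L i})"
    using assms[of i] by (intro finite_measureI) (simp add: divide_ennreal_def ennreal_mult_eq_top_iff)
  then show "sigma_finite_measure (uniform_measure lborel {a i..a i + L i})"
    by (rule finite_measure.axioms(1))
qed

lemma measurable_cube_map:
  "cube_map d a L \<in> measurable (\<Pi>\<^sub>M i\<in>{..<d}. M i) (\<Pi>\<^sub>M i\<in>{..<d}. lborel)"
  if "\<And>i. sets (M i) = sets lborel"
proof -
  have [measurable_cong]: "sets (M i) = sets borel" for i using that by simp
  show ?thesis unfolding cube_map_def by measurable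
qed

text \<open>Normalised Lebesgue measure on the cube and the image of \<open>unit_cube d\<close>
  under \<open>cube_map\<close> agree on boxes with the product of the uniform measures on the
  edges, hence both equal it.\<close>

lemma cube_average:
  assumes L: "L > 0" and g: "g \<in> borel_measurable (\<Pi>\<^sub>M i\<in>{..<d}. lborel)"
  shows "(\<integral>\<^sup>+y\<in>cube d a L. g y \<partial>leb d) / emeasure (leb d) (cube d a L) =
    (\<integral>\<^sup>+u. g (cube_map d a L u) \<partial>unit_cube d)"
proof -
  let ?M = "\<Pi>\<^sub>M i\<in>{..<d}. (lborel :: real measure)"
  let ?MB = "\<lambda>i. uniform_measure lborel {a i..a i + L}"
  interpret B: product_sigma_finite ?MB
    using product_sigma_finite_uniform[of "\<lambda>_. L" a] L by simp
  interpret U: product_sigma_finite "\<lambda>_::nat. uniform_measure lborel {0..1::real}"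
    using product_sigma_finite_uniform[of "\<lambda>_. 1" "\<lambda>_. 0"] by simp
  interpret P: product_sigma_finite "\<lambda>_::nat. lborel :: real measure" ..
  have cube_M: "cube d a L \<in> sets ?M"
    unfolding cube_def by (intro sets_PiM_I_finite) auto
  have emB: "emeasure ?M (cube d a L) = ennreal L ^ d"
    unfolding cube_def using L by (subst P.emeasure_PiM) auto
  have sets_eq: "sets (PiM {..<d} ?MB) = sets ?M"
    by (intro sets_PiM_cong) auto
  have 1: "uniform_measure ?M (cube d a L) = PiM {..<d} ?MB"
  proof (rule B.PiM_eqI)
    fix A assume A: "\<And>i. i \<in> {..<d} \<Longrightarrow> A i \<in> sets (?MB i)"
    have "cube d a L \<inter> PiE {..<d} A = (\<Pi>\<^sub>E i\<in>{..<d}. {a i..a i + L} \<inter> A i)"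
      unfolding cube_def by auto
    then have "emeasure (uniform_measure ?M (cube d a L)) (PiE {..<d} A) =
        (\<Prod>i<d. emeasure lborel ({a i..a i + L} \<inter> A i)) / ennreal L ^ d"
      using A cube_M by (simp add: emB emeasure_uniform_measure sets_PiM_I_finite)
        (subst P.emeasure_PiM, auto)
    also have "\<dots> = (\<Prod>i<d. emeasure lborel ({a i..a i + L} \<inter> A i) / ennreal L)"
      unfolding divide_ennreal_def by (simp only: prod.distrib prod_constant ennreal_inverse_power card_lessThan)
    also have "\<dots> = (\<Prod>i<d. emeasure (?MB i) (A i))"
      using A L by (intro prod.cong refl) (subst emeasure_uniform_measure, auto)
    finally show "emeasure (uniform_measure ?M (cube d a L)) (PiE {..<d} A) =
        (\<Prod>i<d. emeasure (?MB i) (A i))" .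
  qed (use sets_eq in auto)
  have meas: "cube_map d a L \<in> measurable (unit_cube d) ?M"
    unfolding unit_cube_def by (rule measurable_cube_map) simp
  have 2: "distr (unit_cube d) ?M (cube_map d a L) = PiM {..<d} ?MB"
  proof (rule B.PiM_eqI)
    fix A assume A: "\<And>i. i \<in> {..<d} \<Longrightarrow> A i \<in> sets (?MB i)"
    have "cube_map d a L -` PiE {..<d} A \<inter> space (unit_cube d) =
        (\<Pi>\<^sub>E i\<in>{..<d}. {v. a i + L * v \<in> A i})"
    proof (intro set_eqI)
      fix u
      have "cube_map d a L u \<in> PiE {..<d} A \<longleftrightarrow> (\<forall>i<d. a i + L * u i \<in> A i)"
        by (simp add: cube_map_def PiE_iff Ball_def)
      then show "u \<in> cube_map d a L -` PiE {..<d} A \<inter> space (unit_cube d) \<longleftrightarrow>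
          u \<in> (\<Pi>\<^sub>E i\<in>{..<d}. {v. a i + L * v \<in> A i})"
        by (auto simp: unit_cube_def space_PiM PiE_iff)
    qed
    then have "emeasure (distr (unit_cube d) ?M (cube_map d a L)) (PiE {..<d} A) =
        emeasure (unit_cube d) (\<Pi>\<^sub>E i\<in>{..<d}. {v. a i + L * v \<in> A i})"
      using A meas by (subst emeasure_distr) (auto intro!: sets_PiM_I_finite)
    also have "\<dots> = (\<Prod>i<d. emeasure (uniform_measure lborel {0..1}) {v. a i + L * v \<in> A i})"
      unfolding unit_cube_def
    proof (rule U.emeasure_PiM)
      fix i assume "i \<in> {..<d}"
      then have [measurable]: "A i \<in> sets borel" using A[of i] by simp
      show "{v. a i + L * v \<in> A i} \<in> sets (uniform_measure lborel {0..1})" by simp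
    qed simp
    also have "\<dots> = (\<Prod>i<d. emeasure (?MB i) (A i))"
      using A L by (intro prod.cong refl emeasure_uniform_lborel_affine) auto
    finally show "emeasure (distr (unit_cube d) ?M (cube_map d a L)) (PiE {..<d} A) =
        (\<Prod>i<d. emeasure (?MB i) (A i))" .
  qed (use sets_eq in auto)
  have "(\<integral>\<^sup>+y\<in>cube d a L. g y \<partial>leb d) / emeasure (leb d) (cube d a L) =
      (\<integral>\<^sup>+y\<in>cube d a L. g y \<partial>?M) / emeasure ?M (cube d a L)"
    unfolding leb_def using cube_M by (simp add: nn_integral_completion)
  also have "\<dots> = integral\<^sup>N (uniform_measure ?M (cube d a L)) g"
    using cube_M g by (subst nn_integral_uniform_measure) (auto simp: mult.commute)
  also have "\<dots> = integral\<^sup>N (distr (unit_cube d) ?M (cube_map d a L)) g"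
    by (simp only: 1 2)
  also have "\<dots> = (\<integral>\<^sup>+u. g (cube_map d a L u) \<partial>unit_cube d)"
    using meas g by (subst nn_integral_distr) auto
  finally show ?thesis .
qed

section \<open>Measurability of Lipschitz functions\<close>

text \<open>After extension to all sequences by restricting the argument, \<open>f\<close> is
  continuous in the product topology, whose Borel sets are those of the countable product. The
  inclusion of the \<open>d\<close>-dimensional space is measurable.\<close>

lemma Lipschitz_measurable:
  assumes f: "\<And>x y. x \<in> Rd d \<Longrightarrow> y \<in> Rd d \<Longrightarrow> \<bar>f x - f y\<bar> \<le> K * dist_inf d x y" and d: "d \<ge> 1"
  shows "f \<in> borel_measurable (\<Pi>\<^sub>M i\<in>{..<d}. lborel)"
proof -
  define g where "g x = f (restrict x {..<d})" for x
  \<comment> \<open>The sum dominates the maximum and tends to 0 coordinate by coordinate; the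
    absolute value of \<open>K\<close> makes the factor nonnegative, as monotonicity
    requires.\<close>
  have le: "\<bar>g x - g y\<bar> \<le> \<bar>K\<bar> * (\<Sum>i<d. \<bar>x i - y i\<bar>)" for x y
  proof -
    have "\<bar>g x - g y\<bar> \<le> K * dist_inf d (restrict x {..<d}) (restrict y {..<d})"
      unfolding g_def by (rule f) (auto simp: Rd_def)
    also have "dist_inf d (restrict x {..<d}) (restrict y {..<d}) = dist_inf d x y"
      by (rule dist_inf_cong) auto
    also have "K * dist_inf d x y \<le> \<bar>K\<bar> * dist_inf d x y"
      using d by (intro mult_right_mono) (auto simp: dist_inf_def norm_inf_nonneg)
    also have "dist_inf d x y \<le> (\<Sum>i<d. \<bar>x i - y i\<bar>)"
      using d unfolding dist_inf_def by (auto simp: norm_inf_le_iff intro!: member_le_sum)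
    finally show ?thesis by (simp add: mult_left_mono)
  qed
  have "(g \<longlongrightarrow> g x) (at x)" for x
  proof (rule LIM_zero_cancel, rule Lim_null_comparison)
    show "\<forall>\<^sub>F y in at x. norm (g y - g x) \<le> \<bar>K\<bar> * (\<Sum>i<d. \<bar>y i - x i\<bar>)"
      using le by simp
    have "((\<lambda>y. y i) \<longlongrightarrow> x i) (at x)" for i
      using continuous_on_product_coordinates[of i, where ?'b = real]
      by (simp add: continuous_on_def)
    from tendsto_diff[OF this tendsto_const[of "x _"]]
    have "((\<lambda>y. y i - x i) \<longlongrightarrow> 0) (at x)" for i
      using LIM_zero \<open>\<And>i. ((\<lambda>y. y i) \<longlongrightarrow> x i) (at x)\<close> by blast
    then show "((\<lambda>y. \<bar>K\<bar> * (\<Sum>i<d. \<bar>y i - x i\<bar>)) \<longlongrightarrow> 0) (at x)"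
      by (intro tendsto_mult_right_zero tendsto_null_sum tendsto_rabs_zero)
  qed
  then have "continuous_on UNIV g"
    by (simp add: continuous_on_def)
  then have [measurable]: "g \<in> borel_measurable (\<Pi>\<^sub>M i\<in>UNIV. borel)"
    using borel_measurable_continuous_onI[of g]
    by (simp add: measurable_cong_sets[OF sets_PiM_equal_borel refl])
  have "(\<lambda>x i. x i) \<in> measurable (\<Pi>\<^sub>M i\<in>{..<d}. lborel) (\<Pi>\<^sub>M i\<in>UNIV. (borel :: real measure))"
  proof (rule measurable_PiM_single')
    fix i :: nat
    show "(\<lambda>x. x i) \<in> borel_measurable (\<Pi>\<^sub>M i\<in>{..<d}. (lborel :: real measure))"
    \<comment> \<open>Extensional functions are constantly \<open>undefined\<close> beyond
      \<open>d\<close>, so those coordinates are constant.\<close>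
    proof (cases "i < d")
      case False
      then have *: "x i = undefined" if "x \<in> space (\<Pi>\<^sub>M i\<in>{..<d}. (lborel :: real measure))" for x
        using that by (simp add: space_PiM PiE_def extensional_def)
      show ?thesis
        by (subst measurable_cong[where g = "\<lambda>_. undefined"]) (use * in simp_all)
    next
      case True
      then show ?thesis
        using measurable_component_singleton[of i "{..<d}" "\<lambda>_. lborel :: real measure"] by simp
    qed
  qed auto
  from measurable_comp[OF this \<open>g \<in> _\<close>]
  have "g \<in> borel_measurable (\<Pi>\<^sub>M i\<in>{..<d}. lborel)"
    by (simp add: o_def)
  then show ?thesis
  proof (rule measurable_cong[THEN iffD1, rotated])
    show "g x = f x" if "x \<in> space (\<Pi>\<^sub>M i\<in>{..<d}. (lborel :: real measure))" for x
      using that by (simp add: g_def space_PiM PiE_restrict)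
  qed
qed

subsection \<open>Integrals of the tent function\<close>

lemma prob_unit_cube: "emeasure (unit_cube d) (space (unit_cube d)) = 1"
proof -
  interpret U: product_sigma_finite "\<lambda>_::nat. uniform_measure lborel {0..1::real}"
    using product_sigma_finite_uniform[of "\<lambda>_. 1" "\<lambda>_. 0"] by simp
  show ?thesis
    unfolding unit_cube_def space_PiM by (subst U.emeasure_PiM) (auto simp: divide_ennreal_def)
qed

text \<open>Layer cake: the superlevel sets of the tent function \<open>max 0 (1 - \<parallel>x\<parallel>)\<close> are cubes.\<close>

lemma tent_integral:
  assumes d: "d \<ge> 1" and L: "L > 0"
  shows "(\<integral>\<^sup>+u. ennreal (max 0 (1 - norm_inf d (cube_map d a L u))) \<partial>unit_cube d) =
    (\<integral>\<^sup>+t\<in>{0..1}. (\<Prod>i<d. emeasure (uniform_measure lborel {a i..a i + L}) {-t..t}) \<partial>lborel)"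
proof -
  interpret U: product_sigma_finite "\<lambda>_::nat. uniform_measure lborel {0..1::real}"
    using product_sigma_finite_uniform[of "\<lambda>_. 1" "\<lambda>_. 0"] by simp
  interpret pair_sigma_finite "unit_cube d" "lborel :: real measure"
    unfolding unit_cube_def by (rule pair_sigma_finite.intro[OF U.sigma_finite[OF finite_lessThan] sigma_finite_lborel])
  \<comment> \<open>As a function of \<open>t\<close> this is the indicator of
    \<open>{n..1}\<close>, with \<open>n\<close> the norm, whose length is the tent function.
    Written coordinatewise, its sections at fixed \<open>t\<close> are boxes.\<close>
  define k where "k u t = (if 0 \<le> t \<and> t \<le> 1 \<and> (\<forall>i\<in>{..<d}. \<bar>a i + L * u i\<bar> \<le> t) then 1 else 0 :: ennreal)"
    for u t
  have sets_eq: "sets (unit_cube d) = sets (PiM {..<d} (\<lambda>_. lborel))"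
    unfolding unit_cube_def by (intro sets_PiM_cong) auto
  have coord: "(\<lambda>p. fst p i) \<in> borel_measurable (unit_cube d \<Otimes>\<^sub>M lborel)" if "i \<in> {..<d}" for i
  proof (rule measurable_compose[OF measurable_fst])
    show "(\<lambda>u. u i) \<in> borel_measurable (unit_cube d)"
      using measurable_component_singleton[of i "{..<d}" "\<lambda>_. lborel :: real measure"] that
      by (simp add: measurable_cong_sets[OF sets_eq])
  qed
  have [measurable]: "case_prod k \<in> borel_measurable (unit_cube d \<Otimes>\<^sub>M lborel)"
  proof -
    have [measurable]: "Measurable.pred (unit_cube d \<Otimes>\<^sub>M (lborel :: real measure)) 
        (\<lambda>p. \<bar>a i + L * fst p i\<bar> \<le> snd p)" if "i \<in> {..<d}" for i
      using coord[OF that] by measurable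
    show ?thesis
      unfolding k_def case_prod_beta by measurable
  qed
  have "(\<integral>\<^sup>+u. ennreal (max 0 (1 - norm_inf d (cube_map d a L u))) \<partial>unit_cube d) =
      (\<integral>\<^sup>+u. (\<integral>\<^sup>+t. k u t \<partial>lborel) \<partial>unit_cube d)"
  proof (intro nn_integral_cong)
    fix u
    let ?n = "norm_inf d (cube_map d a L u)"
    have "k u t = indicator {?n..1} t" for t
      using norm_inf_nonneg[OF d, of "cube_map d a L u"] norm_inf_le_iff[OF d, of "cube_map d a L u" t]
      by (auto simp: k_def indicator_def cube_map_def)
    then have "(\<integral>\<^sup>+t. k u t \<partial>lborel) = emeasure lborel {?n..1}"
      by simp
    then show "ennreal (max 0 (1 - ?n)) = (\<integral>\<^sup>+t. k u t \<partial>lborel)"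
      by (cases "?n \<le> 1") (auto simp: max_def)
  qed
  also have "\<dots> = (\<integral>\<^sup>+t. (\<integral>\<^sup>+u. k u t \<partial>unit_cube d) \<partial>lborel)"
    by (rule Fubini'[symmetric]) measurable
  also have "\<dots> = (\<integral>\<^sup>+t\<in>{0..1}. (\<Prod>i<d. emeasure (uniform_measure lborel {a i..a i + L}) {-t..t}) \<partial>lborel)"
  proof (intro nn_integral_cong)
    fix t :: real
    let ?S = "\<Pi>\<^sub>E i\<in>{..<d}. {v. a i + L * v \<in> {-t..t}}"
    have S: "?S \<in> sets (unit_cube d)"
      unfolding unit_cube_def by (intro sets_PiM_I_finite) auto
    have "k u t = indicator {0..1} t * indicator ?S u" if "u \<in> space (unit_cube d)" for u
    proof -
      have "u \<in> ?S \<longleftrightarrow> (\<forall>i\<in>{..<d}. a i + L * u i \<in> {-t..t})"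
        using that by (simp add: unit_cube_def space_PiM PiE_iff)
      moreover have "\<bar>z\<bar> \<le> t \<longleftrightarrow> z \<in> {-t..t}" for z
        by auto
      ultimately show ?thesis
        unfolding k_def by (simp add: indicator_def del: atLeastAtMost_iff) simp
    qed
    then have "(\<integral>\<^sup>+u. k u t \<partial>unit_cube d) = (\<integral>\<^sup>+u. indicator {0..1} t * indicator ?S u \<partial>unit_cube d)"
      by (intro nn_integral_cong) auto
    also have "\<dots> = indicator {0..1} t * emeasure (unit_cube d) ?S"
      using S by (simp add: nn_integral_cmult)
    also have "emeasure (unit_cube d) ?S =
        (\<Prod>i<d. emeasure (uniform_measure lborel {0..1}) {v. a i + L * v \<in> {-t..t}})"
      unfolding unit_cube_def by (rule U.emeasure_PiM) auto
    also have "\<dots> = (\<Prod>i<d. emeasure (uniform_measure lborel {a i..a i + L}) {-t..t})"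
      using L by (intro prod.cong refl emeasure_uniform_lborel_affine) auto
    finally show "(\<integral>\<^sup>+u. k u t \<partial>unit_cube d) =
        (\<Prod>i<d. emeasure (uniform_measure lborel {a i..a i + L}) {-t..t}) * indicator {0..1} t"
      by (simp add: mult.commute)
  qed
  finally show ?thesis .
qed

text \<open>\<open>profile \<alpha> t\<close> is the fraction of \<open>[-\<alpha>, 1]\<close> contained in \<open>[-t, t]\<close>, for \<open>0 \<le> t \<le> 1\<close>, and
  \<open>tent_mass d \<alpha>\<close> is the mean of \<open>max 0 (1 - \<parallel>x\<parallel>)\<close> over \<open>[-\<alpha>, 1]\<^sup>d\<close>, for \<open>0 \<le> \<alpha> \<le> 1\<close>.\<close>

definition profile :: "real \<Rightarrow> real \<Rightarrow> real" where
  "profile \<alpha> t = min (2 * t) (t + \<alpha>) / (1 + \<alpha>)"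

definition tent_mass :: "nat \<Rightarrow> real \<Rightarrow> real" where
  "tent_mass d \<alpha> = (1 + \<alpha> - \<alpha> * (2 * \<alpha> / (1 + \<alpha>)) ^ d) / (real d + 1)"

lemma emeasure_uniform_interval:
  fixes a L t :: real
  assumes "L > 0"
  shows "emeasure (uniform_measure lborel {a..a + L}) {-t..t} =
    ennreal (max 0 (min (a + L) t - max a (- t)) / L)"
proof -
  have Icc: "emeasure lborel {p..q} = ennreal (max 0 (q - p))" for p q :: real
    by (cases "p \<le> q") auto
  have "emeasure lborel {max a (- t)..min (a + L) t} = ennreal (max 0 (min (a + L) t - max a (- t)))"
    using Icc[of "max a (- t)" "min (a + L) t"] .
  then show ?thesis
    using assms by (simp add: emeasure_uniform_measure divide_ennreal)
qed

lemma nn_integral_profile: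
  assumes \<alpha>: "0 \<le> \<alpha>" "\<alpha> \<le> 1"
  shows "(\<integral>\<^sup>+t\<in>{0..1}. ennreal (profile \<alpha> t) ^ d \<partial>lborel) = ennreal (tent_mass d \<alpha>)"
proof -
  let ?D = "real d + 1"
  \<comment> \<open>\<open>F\<close> and \<open>G\<close> are antiderivatives of
    \<open>profile \<alpha> t ^ d\<close> on \<open>{0..\<alpha>}\<close> and
    \<open>{\<alpha>..1}\<close>, the two ranges on which the minimum is \<open>2 * t\<close> and
    \<open>t + \<alpha>\<close>. The summand 0 lets \<open>pow\<close> serve both.\<close>
  define F where "F t = (2 / (1 + \<alpha>)) ^ d * ((t + 0) ^ Suc d / real (Suc d))" for t
  define G where "G t = (1 / (1 + \<alpha>)) ^ d * ((t + \<alpha>) ^ Suc d / real (Suc d))" for t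
  have pow: "((\<lambda>t. (t + c) ^ Suc d / real (Suc d)) has_real_derivative (t + c) ^ d) (at t within S)"
    for c t :: real and S
    by (auto intro!: derivative_eq_intros simp del: of_nat_Suc power_Suc)
  have "((\<lambda>t. profile \<alpha> t ^ d) has_integral F \<alpha> - F 0) {0..\<alpha>}"
  proof (rule has_integral_eq[rotated, OF fundamental_theorem_of_calculus[OF \<alpha>(1)]])
    fix t assume "t \<in> {0..\<alpha>}"
    show "(F has_vector_derivative (2 * t / (1 + \<alpha>)) ^ d) (at t within {0..\<alpha>})"
      unfolding F_def has_real_derivative_iff_has_vector_derivative[symmetric]
      using DERIV_cmult[OF pow[of 0], of "(2 / (1 + \<alpha>)) ^ d"]
      by (simp add: power_divide power_mult_distrib)
  qed (auto simp: profile_def)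
  moreover have "((\<lambda>t. profile \<alpha> t ^ d) has_integral G 1 - G \<alpha>) {\<alpha>..1}"
  proof (rule has_integral_eq[rotated, OF fundamental_theorem_of_calculus[OF \<alpha>(2)]])
    fix t assume "t \<in> {\<alpha>..1}"
    show "(G has_vector_derivative ((t + \<alpha>) / (1 + \<alpha>)) ^ d) (at t within {\<alpha>..1})"
      unfolding G_def has_real_derivative_iff_has_vector_derivative[symmetric]
      using DERIV_cmult[OF pow[of \<alpha>], of "(1 / (1 + \<alpha>)) ^ d"]
      by (simp add: power_divide)
  qed (auto simp: profile_def)
  ultimately have "((\<lambda>t. profile \<alpha> t ^ d) has_integral (F \<alpha> - F 0) + (G 1 - G \<alpha>)) {0..1}"
    using \<alpha> by (intro has_integral_combine) auto
  also have "(F \<alpha> - F 0) + (G 1 - G \<alpha>) = tent_mass d \<alpha>"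
  proof -
    have "F \<alpha> = \<alpha> * (2 * \<alpha> / (1 + \<alpha>)) ^ d / ?D" "G \<alpha> = 2 * \<alpha> * (2 * \<alpha> / (1 + \<alpha>)) ^ d / ?D"
      "G 1 = (1 + \<alpha>) / ?D" "F 0 = 0"
      using \<alpha> unfolding F_def G_def
      by (simp_all add: power_divide power_mult_distrib add.commute flip: mult_2)
    then show ?thesis
      by (simp add: tent_mass_def diff_divide_distrib add_divide_distrib)
  qed
  finally have int: "((\<lambda>t. profile \<alpha> t ^ d) has_integral tent_mass d \<alpha>) {0..1}" .
  have nonneg: "0 \<le> profile \<alpha> t" if "t \<in> {0..1}" for t
    using that \<alpha> by (auto simp: profile_def)
  have "(\<integral>\<^sup>+t. ennreal (profile \<alpha> t ^ d * indicator {0..1} t) \<partial>lborel) = ennreal (tent_mass d \<alpha>)"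
  proof (rule nn_integral_has_integral_lborel)
    show "(\<lambda>t. profile \<alpha> t ^ d * indicator {0..1} t) \<in> borel_measurable borel"
      unfolding profile_def by measurable
    show "0 \<le> profile \<alpha> t ^ d * indicator {0..1} t" for t
      using nonneg[of t] by (auto simp: indicator_def)
    have "((\<lambda>t. if t \<in> {0..1} then profile \<alpha> t ^ d else 0) has_integral tent_mass d \<alpha>) UNIV"
      using int by (simp only: has_integral_restrict_UNIV)
    then show "((\<lambda>t. profile \<alpha> t ^ d * indicator {0..1} t) has_integral tent_mass d \<alpha>) UNIV"
      by (rule has_integral_eq[rotated]) auto
  qed
  moreover have "ennreal (profile \<alpha> t) ^ d * indicator {0..1} t = ennreal (profile \<alpha> t ^ d * indicator {0..1} t)" for t
    using nonneg[of t] by (auto simp: indicator_def ennreal_power)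
  ultimately show ?thesis
    by simp
qed

text \<open>Each edge is \<open>{-\<alpha>..1}\<close> or its reflection
  \<open>{-1..\<alpha>}\<close>, and the symmetric interval \<open>{-t..t}\<close> meets both in the
  same length.\<close>

lemma tent_integral_displacement:
  assumes d: "d \<ge> 1" and \<alpha>: "0 \<le> \<alpha>" "\<alpha> \<le> 1" and b: "\<And>i. i < d \<Longrightarrow> b i = - \<alpha> \<or> b i = - 1"
  shows "(\<integral>\<^sup>+u. ennreal (max 0 (1 - norm_inf d (cube_map d b (1 + \<alpha>) u))) \<partial>unit_cube d) =
    ennreal (tent_mass d \<alpha>)"
proof -
  have "emeasure (uniform_measure lborel {b i..b i + (1 + \<alpha>)}) {-t..t} = ennreal (profile \<alpha> t)"
    if "i < d" "t \<in> {0..1}" for i t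
    using b[OF that(1)] that(2) \<alpha> unfolding profile_def
    by (subst emeasure_uniform_interval) (auto intro!: arg_cong[where f = ennreal] simp: min_def max_def)
  then show ?thesis
    using d \<alpha> by (subst tent_integral)
      (auto simp: indicator_def simp flip: nn_integral_profile intro!: nn_integral_cong)
qed

text \<open>A lower bound on the gap to \<open>2 / (d + 1)\<close> that is uniform in \<open>\<alpha>\<close> gives the strict inequality
  for the operator norm.\<close>

lemma tent_mass_le:
  assumes \<alpha>: "0 \<le> \<alpha>" "\<alpha> \<le> 1"
  shows "tent_mass d \<alpha> \<le> (2 - (2 / 3) ^ d / 2) / (real d + 1)"
proof -
  have "1 + \<alpha> - \<alpha> * (2 * \<alpha> / (1 + \<alpha>)) ^ d \<le> 2 - (2 / 3) ^ d / 2"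
  \<comment> \<open>Up to 1/2 the term \<open>1 + \<alpha>\<close> alone is at most 3/2; beyond 1/2
    the base of the power is at least 2/3 and its coefficient at least 1/2.\<close>
  proof (cases "\<alpha> \<le> 1 / 2")
    case True
    have "0 \<le> \<alpha> * (2 * \<alpha> / (1 + \<alpha>)) ^ d" "(2 / 3 :: real) ^ d \<le> 1"
      using \<alpha> by (auto intro: power_le_one)
    with True show ?thesis by linarith
  next
    case False
    then have "2 / 3 \<le> 2 * \<alpha> / (1 + \<alpha>)" by (simp add: field_simps)
    then have "(1 / 2) * (2 / 3) ^ d \<le> \<alpha> * (2 * \<alpha> / (1 + \<alpha>)) ^ d"
      using False by (intro mult_mono power_mono) auto
    with \<alpha> show ?thesis by simp
  qed
  then show ?thesis
    unfolding tent_mass_def by (intro divide_right_mono) auto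
qed

text \<open>Among intervals of length \<open>L\<close> containing 1, the one ending at 1 covers most
  of \<open>{-t..t}\<close>. Lengths below 1 or above 2 do no better than 1 or 2, so in every
  coordinate \<open>profile \<beta>\<close> dominates with the same \<beta>.\<close>

lemma tent_integral_le:
  assumes d: "d \<ge> 1" and L: "L > 0" and a: "\<And>i. i < d \<Longrightarrow> a i \<le> 1 \<and> 1 \<le> a i + L"
  shows "(\<integral>\<^sup>+u. ennreal (max 0 (1 - norm_inf d (cube_map d a L u))) \<partial>unit_cube d) \<le>
    ennreal ((2 - (2 / 3) ^ d / 2) / (real d + 1))"
proof -
  define \<beta> where "\<beta> = min 1 (max 0 (L - 1))"
  have \<beta>: "0 \<le> \<beta>" "\<beta> \<le> 1" by (auto simp: \<beta>_def)
  have le: "emeasure (uniform_measure lborel {a i..a i + L}) {-t..t} \<le> ennreal (profile \<beta> t)"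
    if "i < d" "t \<in> {0..1}" for i t
  proof -
    have t: "0 \<le> t" "t \<le> 1" using that(2) by auto
    \<comment> \<open>Here \<open>t \<le> 1 \<le> a i + L\<close>, so the upper end is
      \<open>t\<close>, and \<open>a i \<ge> 1 - L\<close>.\<close>
    have "max 0 (min (a i + L) t - max (a i) (- t)) \<le> max 0 (min (2 * t) (t + (L - 1)))"
      using a[OF that(1)] by (auto simp: max_def min_def)
    then have "max 0 (min (a i + L) t - max (a i) (- t)) / L \<le> max 0 (min (2 * t) (t + (L - 1))) / L"
      using L by (intro divide_right_mono) auto
    also have "\<dots> \<le> profile \<beta> t"
    proof -
      \<comment> \<open>In the two outer cases \<beta> is 0 or 1 and
        \<open>profile \<beta> t\<close> is just \<open>t\<close>.\<close>
      consider "L \<le> 1" | "1 \<le> L" "L \<le> 2" | "2 \<le> L" by linarith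
      then show ?thesis
      proof cases
        case 1
        have "0 \<le> (1 - t) * (1 - L)" using 1 t by simp
        then have "t + (L - 1) \<le> t * L" by (simp add: algebra_simps)
        moreover have "0 \<le> t * L" using t L by simp
        ultimately have "max 0 (min (2 * t) (t + (L - 1))) \<le> t * L" by simp
        then show ?thesis
          using 1 t L by (simp add: \<beta>_def profile_def pos_divide_le_eq)
      next
        case 2
        then show ?thesis using t by (simp add: \<beta>_def profile_def)
      next
        case 3
        have "2 * t \<le> t * L" using mult_left_mono[OF 3 t(1)] by simp
        moreover have "0 \<le> t * L" using t L by simp
        ultimately have "max 0 (min (2 * t) (t + (L - 1))) \<le> t * L" by simp
        then show ?thesis
          using 3 t L by (simp add: \<beta>_def profile_def pos_divide_le_eq)
      qed
    qed
    finally show ?thesis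
      unfolding emeasure_uniform_interval[OF L] by (rule ennreal_leI)
  qed
  have "(\<integral>\<^sup>+u. ennreal (max 0 (1 - norm_inf d (cube_map d a L u))) \<partial>unit_cube d) \<le>
      (\<integral>\<^sup>+t\<in>{0..1}. ennreal (profile \<beta> t) ^ d \<partial>lborel)"
    unfolding tent_integral[OF d L]
  proof (intro nn_integral_mono)
    fix t :: real
    have "(\<Prod>i<d. emeasure (uniform_measure lborel {a i..a i + L}) {-t..t}) \<le> (\<Prod>i<d. ennreal (profile \<beta> t))"
      if "t \<in> {0..1}"
      using le that by (intro prod_mono_ennreal) auto
    then show "(\<Prod>i<d. emeasure (uniform_measure lborel {a i..a i + L}) {-t..t}) * indicator {0..1} t \<le>
        ennreal (profile \<beta> t) ^ d * indicator {0..1} t"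
      by (auto simp: indicator_def)
  qed
  also have "\<dots> \<le> ennreal ((2 - (2 / 3) ^ d / 2) / (real d + 1))"
    unfolding nn_integral_profile[OF \<beta>] by (intro ennreal_leI tent_mass_le \<beta>)
  finally show ?thesis .
qed

subsection \<open>Bounds for the operator norm\<close>

lemma le_Lip:
  assumes "x \<in> Rd d" "y \<in> Rd d" "x \<noteq> y"
  shows "(if g x = g y then 0 else \<bar>g x - g y\<bar>) / ereal (dist_inf d x y) \<le> Lip d g"
  unfolding Lip_def by (rule SUP_upper2[of "(x, y)"]) (use assms in auto)

lemma Lip_leI:
  assumes "\<And>x y. x \<in> Rd d \<Longrightarrow> y \<in> Rd d \<Longrightarrow> x \<noteq> y \<Longrightarrow>
    (if g x = g y then 0 else \<bar>g x - g y\<bar>) \<le> ereal (dist_inf d x y) * C"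
  shows "Lip d g \<le> C"
  unfolding Lip_def
proof (intro SUP_least, clarify)
  fix x y assume "x \<in> Rd d" "y \<in> Rd d" "x \<noteq> y"
  with assms[OF this] dist_inf_pos[OF this]
  show "(if g x = g y then 0 else \<bar>g x - g y\<bar>) / ereal (dist_inf d x y) \<le> C"
    by (subst ereal_divide_le_pos) auto
qed

lemma Lip_finite_bound:
  assumes "0 < Lip d (\<lambda>x. ereal (f x))" "Lip d (\<lambda>x. ereal (f x)) < \<infinity>"
  obtains K where "K > 0" "Lip d (\<lambda>x. ereal (f x)) = ereal K"
    "\<And>x y. x \<in> Rd d \<Longrightarrow> y \<in> Rd d \<Longrightarrow> \<bar>f x - f y\<bar> \<le> K * dist_inf d x y"
proof -
  obtain K where K: "Lip d (\<lambda>x. ereal (f x)) = ereal K"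
    using assms by (cases "Lip d (\<lambda>x. ereal (f x))") auto
  moreover have "K > 0" using assms K by simp
  moreover have "\<bar>f x - f y\<bar> \<le> K * dist_inf d x y" if "x \<in> Rd d" "y \<in> Rd d" for x y
  proof (cases "x = y")
    case True
    have "dist_inf d y y = \<bar>0\<bar>" if "d > 0"
      unfolding dist_inf_def norm_inf_def using that by (simp add: image_constant_conv lessThan_empty_iff)
    \<comment> \<open>In dimension 0 there is only one point, so the supremum ranges over the empty
      set and cannot be positive.\<close>
    moreover have "d > 0"
    proof (rule ccontr)
      assume "\<not> d > 0"
      then have "x = y" if "x \<in> Rd d" "y \<in> Rd d" for x y
        using that by (simp add: Rd_def)
      then have "Lip d (\<lambda>x. ereal (f x)) \<le> 0"
        by (intro Lip_leI) auto
      with assms show False by simp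
    qed
    ultimately show ?thesis using True by simp
  next
    case False
    have "\<bar>ereal (f x) - ereal (f y)\<bar> / ereal (dist_inf d x y) \<le> ereal K"
      using le_Lip[OF that False, of "\<lambda>x. ereal (f x)"] by (cases "f x = f y") (simp_all add: K)
    then show ?thesis
      using dist_inf_pos[OF that False] by (simp add: field_simps)
  qed
  ultimately show ?thesis using that by blast
qed

text \<open>Together with \<open>maximal_leI\<close> this replaces the supremum over balls by
  integrals over \<open>unit_cube d\<close>; balls do not occur afterwards.\<close>

lemma average_le_maximal:
  assumes d: "d \<ge> 1" and L: "L > 0" and x: "x \<in> cube d a L"
    and f: "f \<in> borel_measurable (\<Pi>\<^sub>M i\<in>{..<d}. lborel)"
  shows "(\<integral>\<^sup>+u. ennreal \<bar>f (cube_map d a L u)\<bar> \<partial>unit_cube d) \<le> maximal d f x"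
proof -
  have "(\<integral>\<^sup>+u. ennreal \<bar>f (cube_map d a L u)\<bar> \<partial>unit_cube d) =
      (\<integral>\<^sup>+y\<in>cube d a L. ennreal \<bar>f y\<bar> \<partial>leb d) / emeasure (leb d) (cube d a L)"
    using L f by (subst cube_average) auto
  also have "\<dots> \<le> maximal d f x"
    unfolding maximal_def
  proof (rule SUP_upper, rule CollectI, intro exI conjI)
    show "cube d a L = ball_inf d (\<lambda>i\<in>{..<d}. a i + L / 2) (L / 2)"
      by (rule cube_eq_ball_inf[OF d])
    then show "x \<in> ball_inf d (\<lambda>i\<in>{..<d}. a i + L / 2) (L / 2)"
      using x by simp
  qed (use L in \<open>auto simp: Rd_def\<close>)
  finally show ?thesis .
qed

lemma maximal_leI:
  assumes d: "d \<ge> 1" and f: "f \<in> borel_measurable (\<Pi>\<^sub>M i\<in>{..<d}. lborel)"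
    and le: "\<And>a L. L > 0 \<Longrightarrow> x \<in> cube d a L \<Longrightarrow>
      (\<integral>\<^sup>+u. ennreal \<bar>f (cube_map d a L u)\<bar> \<partial>unit_cube d) \<le> C"
  shows "maximal d f x \<le> C"
  unfolding maximal_def
proof (intro SUP_least)
  fix B assume "B \<in> {ball_inf d c r |c r. c \<in> Rd d \<and> 0 < r \<and> x \<in> ball_inf d c r}"
  then obtain c r where B: "B = cube d (\<lambda>i. c i - r) (2 * r)" "0 < r" "x \<in> B"
    using ball_inf_eq_cube[OF d] by auto
  then show "(\<integral>\<^sup>+y\<in>B. ennreal \<bar>f y\<bar> \<partial>leb d) / emeasure (leb d) B \<le> C"
    using f le[of "2 * r" "\<lambda>i. c i - r"] unfolding B(1) by (subst cube_average) auto
qed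

lemma measurable_cube_map_unit:
  assumes "f \<in> borel_measurable (\<Pi>\<^sub>M i\<in>{..<d}. lborel)"
  shows "(\<lambda>u. f (cube_map d a L u)) \<in> borel_measurable (unit_cube d)"
  using measurable_compose[OF measurable_cube_map assms, of "\<lambda>_. uniform_measure lborel {0..1}"]
  unfolding unit_cube_def by simp

section \<open>The upper bound by stretching cubes\<close>

lemma norm_inf_diff_le:
  assumes "d \<ge> 1"
  shows "\<bar>norm_inf d x - norm_inf d y\<bar> \<le> dist_inf d x y"
proof -
  have "norm_inf d x \<le> norm_inf d y + dist_inf d x y" for x y
    unfolding norm_inf_le_iff[OF assms]
  proof (intro allI impI)
    fix i assume "i < d"
    then show "\<bar>x i\<bar> \<le> norm_inf d y + dist_inf d x y"
      using abs_le_norm_inf[of i d y] abs_le_norm_inf[of i d "\<lambda>i. x i - y i"]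
      unfolding dist_inf_def by linarith
  qed
  from this[of x y] this[of y x] show ?thesis
    using dist_inf_cong[of d x y y x] by (simp add: abs_minus_commute)
qed

lemma norm_inf_measurable: "d \<ge> 1 \<Longrightarrow> norm_inf d \<in> borel_measurable (\<Pi>\<^sub>M i\<in>{..<d}. lborel)"
  using norm_inf_diff_le[of d] Lipschitz_measurable[of d "norm_inf d" 1] by simp

lemma tent_mass_nonneg:
  assumes \<alpha>: "0 \<le> \<alpha>" "\<alpha> \<le> 1"
  shows "0 \<le> tent_mass d \<alpha>"
proof -
  have "\<alpha> * (2 * \<alpha> / (1 + \<alpha>)) ^ d \<le> \<alpha> * 1"
    using \<alpha> by (intro mult_left_mono power_le_one) auto
  then show ?thesis
    unfolding tent_mass_def by simp
qed

lemma tent_mass_le_one: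
  assumes d: "d \<ge> 1" and \<alpha>: "0 \<le> \<alpha>" "\<alpha> \<le> 1"
  shows "tent_mass d \<alpha> \<le> 1"
proof -
  have "0 \<le> \<alpha> * (2 * \<alpha> / (1 + \<alpha>)) ^ d" using \<alpha> by simp
  then have "1 + \<alpha> - \<alpha> * (2 * \<alpha> / (1 + \<alpha>)) ^ d \<le> real d + 1"
    using \<alpha>(2) d by linarith
  then show ?thesis
    unfolding tent_mass_def by simp
qed

lemma AE_unit_cube: "AE u in unit_cube d. \<forall>i<d. 0 \<le> u i \<and> u i \<le> 1"
proof -
  interpret U: product_sigma_finite "\<lambda>_::nat. uniform_measure lborel {0..1::real}"
    using product_sigma_finite_uniform[of "\<lambda>_. 1" "\<lambda>_. 0"] by simp
  let ?S = "\<Pi>\<^sub>E i\<in>{..<d}. {0..1::real}"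
  have S: "?S \<in> sets (unit_cube d)"
    unfolding unit_cube_def by (intro sets_PiM_I_finite) auto
  have one: "emeasure (unit_cube d) ?S = 1"
    unfolding unit_cube_def by (subst U.emeasure_PiM) (auto simp: divide_ennreal_def)
  have "emeasure (unit_cube d) (space (unit_cube d) - ?S) = 0"
    using S one prob_unit_cube[of d] by (subst emeasure_compl) auto
  moreover have "{u \<in> space (unit_cube d). \<not> (\<forall>i<d. 0 \<le> u i \<and> u i \<le> 1)} \<subseteq> space (unit_cube d) - ?S"
  proof -
    have "\<forall>i<d. 0 \<le> u i \<and> u i \<le> 1" if "u \<in> ?S" for u
      using that by (simp add: PiE_iff)
    then show ?thesis by blast
  qed
  ultimately show ?thesis
    using sets.compl_sets[OF S] by (intro AE_I)
qed

text \<open>Almost everywhere the norm \<open>n\<close> is at most 1, so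
  \<open>n + max 0 (1 - n) = 1\<close>, and the mean of the second summand is
  \<open>tent_mass d \<alpha>\<close>. Adding first and cancelling this finite value at the end
  avoids subtraction in \<open>ennreal\<close>.\<close>

lemma displacement_integral:
  assumes d: "d \<ge> 1" and \<alpha>: "0 \<le> \<alpha>" "\<alpha> \<le> 1" and b: "\<And>i. i < d \<Longrightarrow> b i = - \<alpha> \<or> b i = - 1"
  shows "(\<integral>\<^sup>+u. ennreal (norm_inf d (cube_map d b (1 + \<alpha>) u)) \<partial>unit_cube d) =
    ennreal (1 - tent_mass d \<alpha>)"
proof -
  let ?n = "\<lambda>u. norm_inf d (cube_map d b (1 + \<alpha>) u)"
  note [measurable] = measurable_cube_map_unit[OF norm_inf_measurable[OF d]]
  have le1: "?n u \<le> 1" if u: "\<forall>i<d. 0 \<le> u i \<and> u i \<le> 1" for u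
    unfolding norm_inf_le_iff[OF d]
  proof (intro allI impI)
    fix i assume i: "i < d"
    define w where "w = (1 + \<alpha>) * u i"
    have "0 \<le> w" "w \<le> (1 + \<alpha>) * 1"
      unfolding w_def using u i \<alpha> by (auto intro!: mult_left_mono mult_nonneg_nonneg)
    moreover have "cube_map d b (1 + \<alpha>) u i = b i + w"
      using i by (simp add: cube_map_def w_def)
    ultimately show "\<bar>cube_map d b (1 + \<alpha>) u i\<bar> \<le> 1"
      using b[OF i] \<alpha> by auto
  qed
  have "(\<integral>\<^sup>+u. ennreal (?n u) \<partial>unit_cube d) + ennreal (tent_mass d \<alpha>) =
      (\<integral>\<^sup>+u. ennreal (?n u) + ennreal (max 0 (1 - ?n u)) \<partial>unit_cube d)"
    using tent_integral_displacement[OF d \<alpha> b] by (subst nn_integral_add) auto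
  also have "\<dots> = (\<integral>\<^sup>+u. 1 \<partial>unit_cube d)"
  proof (intro nn_integral_cong_AE)
    show "AE u in unit_cube d. ennreal (?n u) + ennreal (max 0 (1 - ?n u)) = 1"
      using AE_unit_cube
    proof eventually_elim
      case (elim u)
      then show ?case
        using le1[OF elim] norm_inf_nonneg[OF d] by (simp add: max_absorb2 flip: ennreal_plus)
    qed
  qed
  also have "\<dots> = ennreal (1 - tent_mass d \<alpha>) + ennreal (tent_mass d \<alpha>)"
    using tent_mass_nonneg[OF \<alpha>] tent_mass_le_one[OF d \<alpha>]
    by (simp add: prob_unit_cube flip: ennreal_plus)
  finally show ?thesis
    by (simp add: ennreal_add_eq_top add.commute[of _ "ennreal (tent_mass d \<alpha>)"] ennreal_add_left_cancel)
qed

text \<open>Passing from a cube around \<open>x\<close> to the stretched cube around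
  \<open>y\<close> moves the point with parameter \<open>u\<close> by \<open>h\<close> times
  \<open>cube_map d b (1 + \<alpha>) u\<close>, whose mean norm is
  \<open>1 - tent_mass d \<alpha>\<close>.\<close>

lemma maximal_shift:
  assumes d: "d \<ge> 1" and \<alpha>: "0 \<le> \<alpha>" "\<alpha> \<le> 1" and K: "K \<ge> 0"
    and f: "\<And>x y. x \<in> Rd d \<Longrightarrow> y \<in> Rd d \<Longrightarrow> \<bar>f x - f y\<bar> \<le> K * dist_inf d x y"
    and x: "x \<in> Rd d" and y: "y \<in> Rd d"
  shows "maximal d f x \<le> maximal d f y + ennreal (K * dist_inf d x y * (1 - tent_mass d \<alpha>))"
proof -
  define h where "h = dist_inf d x y"
  \<comment> \<open>In coordinate \<open>i\<close> the lower end moves by \<open>h * b i\<close> and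
    the upper end by \<open>h * (b i + 1 + \<alpha>)\<close>: the side towards \<open>y\<close>
    moves outwards by \<open>h\<close>, the opposite side by \<open>h * \<alpha>\<close>.\<close>
  define b where "b i = (if x i \<le> y i then - \<alpha> else - 1)" for i
  have fm: "f \<in> borel_measurable (\<Pi>\<^sub>M i\<in>{..<d}. lborel)"
    using f d by (rule Lipschitz_measurable)
  have h: "h \<ge> 0" using d by (simp add: h_def dist_inf_def norm_inf_nonneg)
  have diff: "\<bar>x i - y i\<bar> \<le> h" if "i < d" for i
    using abs_le_norm_inf[OF that, of "\<lambda>i. x i - y i"] by (simp add: h_def dist_inf_def)
  show ?thesis
  proof (rule maximal_leI[OF d fm])
    fix a L assume L: "L > 0" and xa: "x \<in> cube d a L"
    let ?a = "\<lambda>i. a i + h * b i" and ?L = "L + h * (1 + \<alpha>)"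
    have "?L > 0" using L h \<alpha> by (simp add: add_pos_nonneg)
    have ya: "y \<in> cube d ?a ?L"
    proof -
      have "?a i \<le> y i \<and> y i \<le> ?a i + ?L" if "i < d" for i
      proof -
        have *: "a i \<le> x i" "x i \<le> a i + L" using xa that by (auto simp: cube_def PiE_iff)
        have "0 \<le> h * \<alpha>" using h \<alpha> by simp
        with * diff[OF that] show ?thesis
          by (auto simp: b_def algebra_simps abs_le_iff)
      qed
      then show ?thesis using y by (auto simp: cube_def Rd_def PiE_iff)
    qed
    have le: "\<bar>f (cube_map d a L u)\<bar> \<le> \<bar>f (cube_map d ?a ?L u)\<bar> + K * h * norm_inf d (cube_map d b (1 + \<alpha>) u)" for u
    proof -
      have "\<bar>f (cube_map d a L u) - f (cube_map d ?a ?L u)\<bar> \<le>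
          K * dist_inf d (cube_map d a L u) (cube_map d ?a ?L u)"
        by (intro f) (auto simp: Rd_def cube_map_def)
      also have "dist_inf d (cube_map d a L u) (cube_map d ?a ?L u) \<le>
          h * norm_inf d (cube_map d b (1 + \<alpha>) u)"
        unfolding dist_inf_def norm_inf_le_iff[OF d]
      proof (intro allI impI)
        fix i assume i: "i < d"
        have "\<bar>cube_map d a L u i - cube_map d ?a ?L u i\<bar> = h * \<bar>cube_map d b (1 + \<alpha>) u i\<bar>"
        proof -
          have "cube_map d a L u i - cube_map d ?a ?L u i = - (h * cube_map d b (1 + \<alpha>) u i)"
            using i by (simp add: cube_map_def algebra_simps)
          then show ?thesis using h by (simp add: abs_mult)
        qed
        then show "\<bar>cube_map d a L u i - cube_map d ?a ?L u i\<bar> \<le> h * norm_inf d (cube_map d b (1 + \<alpha>) u)"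
          using h by (simp add: mult_left_mono abs_le_norm_inf[OF i])
      qed
      finally show ?thesis using K by (simp add: mult_left_mono mult.assoc)
    qed
    note [measurable] = measurable_cube_map_unit[OF fm] measurable_cube_map_unit[OF norm_inf_measurable[OF d]]
    have "(\<integral>\<^sup>+u. ennreal \<bar>f (cube_map d a L u)\<bar> \<partial>unit_cube d) \<le>
        (\<integral>\<^sup>+u. ennreal \<bar>f (cube_map d ?a ?L u)\<bar> +
          ennreal (K * h) * ennreal (norm_inf d (cube_map d b (1 + \<alpha>) u)) \<partial>unit_cube d)"
      using le K h d
      by (intro nn_integral_mono) (auto simp: norm_inf_nonneg ennreal_leI simp flip: ennreal_mult ennreal_plus)
    also have "\<dots> = (\<integral>\<^sup>+u. ennreal \<bar>f (cube_map d ?a ?L u)\<bar> \<partial>unit_cube d) +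
        ennreal (K * h) * (\<integral>\<^sup>+u. ennreal (norm_inf d (cube_map d b (1 + \<alpha>) u)) \<partial>unit_cube d)"
      by (simp add: nn_integral_add nn_integral_cmult)
    also have "(\<integral>\<^sup>+u. ennreal (norm_inf d (cube_map d b (1 + \<alpha>) u)) \<partial>unit_cube d) =
        ennreal (1 - tent_mass d \<alpha>)"
      using d \<alpha> by (intro displacement_integral) (auto simp: b_def)
    also have "ennreal (K * h) * ennreal (1 - tent_mass d \<alpha>) = ennreal (K * h * (1 - tent_mass d \<alpha>))"
      using K h by (intro ennreal_mult'[symmetric]) auto
    finally show "(\<integral>\<^sup>+u. ennreal \<bar>f (cube_map d a L u)\<bar> \<partial>unit_cube d) \<le>
        maximal d f y + ennreal (K * dist_inf d x y * (1 - tent_mass d \<alpha>))"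
      using average_le_maximal[OF d \<open>?L > 0\<close> ya fm] unfolding h_def[symmetric]
      by (meson add_right_mono order_trans)
  qed
qed

text \<open>The shift estimate is applied in both directions. It also shows that the maximal
  function is finite everywhere or infinite everywhere, and in the latter case its Lipschitz
  constant is 0.\<close>

lemma op_norm_Lip_le:
  assumes d: "d \<ge> 1" and \<alpha>: "0 \<le> \<alpha>" "\<alpha> \<le> 1"
  shows "op_norm_Lip d \<le> ereal (1 - tent_mass d \<alpha>)"
  unfolding op_norm_Lip_def
proof (intro SUP_least, clarify)
  fix f assume "0 < Lip d (\<lambda>x. ereal (f x))" "Lip d (\<lambda>x. ereal (f x)) < \<infinity>"
  then obtain K where K: "K > 0" "Lip d (\<lambda>x. ereal (f x)) = ereal K"
    and f: "\<And>x y. x \<in> Rd d \<Longrightarrow> y \<in> Rd d \<Longrightarrow> \<bar>f x - f y\<bar> \<le> K * dist_inf d x y"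
    by (rule Lip_finite_bound) blast
  let ?M = "maximal d f" and ?C = "1 - tent_mass d \<alpha>"
  have C: "?C \<ge> 0" using tent_mass_le_one[OF d \<alpha>] by simp
  have "Lip d (\<lambda>x. enn2ereal (?M x)) \<le> ereal (?C * K)"
  proof (rule Lip_leI)
    fix x y assume xy: "x \<in> Rd d" "y \<in> Rd d" "x \<noteq> y"
    define e where "e = K * dist_inf d x y * ?C"
    have e: "e \<ge> 0"
      using K C dist_inf_pos[OF xy] by (simp add: e_def)
    have sym: "dist_inf d y x = dist_inf d x y"
      by (rule dist_inf_cong) (simp add: abs_minus_commute)
    have le: "?M x \<le> ?M y + ennreal e" "?M y \<le> ?M x + ennreal e"
      using maximal_shift[OF d \<alpha> _ f xy(1,2)] maximal_shift[OF d \<alpha> _ f xy(2,1)] K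
      unfolding e_def sym by auto
    have "(if enn2ereal (?M x) = enn2ereal (?M y) then 0 else \<bar>enn2ereal (?M x) - enn2ereal (?M y)\<bar>) \<le> ereal e"
    proof (cases "?M x" rule: ennreal_cases)
      case (real p)
      with le(2) e have "?M y < top"
        by (metis ennreal_less_top ennreal_plus le_less_trans)
      then obtain q where q: "q \<ge> 0" "?M y = ennreal q"
        by (cases "?M y" rule: ennreal_cases) auto
      have "p \<le> q + e" "q \<le> p + e"
        using le real q e by (simp_all flip: ennreal_plus)
      then show ?thesis
        using real q e by (auto simp: abs_le_iff)
    next
      case top
      with le(1) have "?M y = top"
        by (simp add: top_unique ennreal_add_eq_top)
      with top e show ?thesis by simp
    qed
    then show "(if enn2ereal (?M x) = enn2ereal (?M y) then 0 else \<bar>enn2ereal (?M x) - enn2ereal (?M y)\<bar>)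
        \<le> ereal (dist_inf d x y) * ereal (?C * K)"
      by (simp add: e_def mult_ac)
  qed
  then show "Lip d (\<lambda>x. enn2ereal (?M x)) / Lip d (\<lambda>x. ereal (f x)) \<le> ereal ?C"
    unfolding K(2) using K(1) by (subst ereal_divide_le_pos) (auto simp: mult.commute)
qed

section \<open>The lower bound from the tent function\<close>

definition tent :: "nat \<Rightarrow> (nat \<Rightarrow> real) \<Rightarrow> real" where
  "tent d x = max 0 (1 - norm_inf d x)"

lemma tent_Lipschitz:
  assumes "d \<ge> 1"
  shows "\<bar>tent d x - tent d y\<bar> \<le> 1 * dist_inf d x y"
proof -
  have "\<bar>max 0 (1 - p) - max 0 (1 - q)\<bar> \<le> \<bar>p - q\<bar>" for p q :: real
    by (simp add: max_def abs_if)
  from order_trans[OF this norm_inf_diff_le[OF assms]] show ?thesis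
    by (simp add: tent_def)
qed

text \<open>The origin \<open>o1\<close> and the point \<open>e1\<close> with all coordinates 1 have
  distance 1, and \<open>tent\<close> has Lipschitz constant 1, so the drop of the maximal function
  between them bounds the operator norm from below.\<close>

lemma op_norm_Lip_ge:
  assumes d: "d \<ge> 1"
  shows "ereal (1 - (2 - (2 / 3) ^ d / 2) / (real d + 1)) \<le> op_norm_Lip d"
proof -
  let ?f = "\<lambda>x. ereal (tent d x)" and ?M = "maximal d (tent d)" and ?B = "(2 - (2 / 3) ^ d / 2) / (real d + 1)"
  define o1 where "o1 = (\<lambda>i\<in>{..<d}. 0 :: real)"
  define e1 where "e1 = (\<lambda>i\<in>{..<d}. 1 :: real)"
  have pts: "o1 \<in> Rd d" "e1 \<in> Rd d" by (auto simp: o1_def e1_def Rd_def)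
  have "o1 0 \<noteq> e1 0" using d by (simp add: o1_def e1_def)
  then have ne: "o1 \<noteq> e1" by metis
  have "dist_inf d o1 e1 \<le> 1"
    unfolding dist_inf_def norm_inf_le_iff[OF d] by (simp add: o1_def e1_def)
  moreover have "dist_inf d o1 e1 \<ge> 1"
    using abs_le_norm_inf[of 0 d "\<lambda>i. o1 i - e1 i"] d by (simp add: dist_inf_def o1_def e1_def)
  ultimately have dist: "dist_inf d o1 e1 = 1" by simp
  have "norm_inf d o1 = 0"
    using norm_inf_nonneg[OF d, of o1] by (intro antisym) (simp_all add: norm_inf_le_iff[OF d] o1_def)
  then have tent_o: "tent d o1 = 1" by (simp add: tent_def)
  have "norm_inf d e1 \<ge> 1"
    using abs_le_norm_inf[of 0 d e1] d by (simp add: e1_def)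
  then have tent_e: "tent d e1 = 0" by (simp add: tent_def)
  have meas: "tent d \<in> borel_measurable (\<Pi>\<^sub>M i\<in>{..<d}. lborel)"
    using tent_Lipschitz[OF d] d by (rule Lipschitz_measurable)
  have "Lip d ?f \<le> 1"
    using tent_Lipschitz[OF d] order_trans[OF abs_ge_zero tent_Lipschitz[OF d]]
    by (intro Lip_leI) auto
  moreover have "1 \<le> Lip d ?f"
    using le_Lip[OF pts ne, of ?f] by (simp add: tent_o tent_e dist)
  ultimately have Lip: "Lip d ?f = 1" by simp
  have "?M e1 \<le> ennreal ?B"
  proof (rule maximal_leI[OF d meas])
    fix a L assume L: "L > 0" and "e1 \<in> cube d a L"
    then have "a i \<le> 1 \<and> 1 \<le> a i + L" if "i < d" for i
      using that by (auto simp: cube_def e1_def PiE_iff)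
    then show "(\<integral>\<^sup>+u. ennreal \<bar>tent d (cube_map d a L u)\<bar> \<partial>unit_cube d) \<le> ennreal ?B"
      using tent_integral_le[OF d L] by (simp add: tent_def)
  qed
  moreover have "0 \<le> ?B"
  proof -
    have "(2 / 3 :: real) ^ d \<le> 1" by (intro power_le_one) auto
    then show ?thesis by simp
  qed
  ultimately have Me: "enn2ereal (?M e1) \<le> ereal ?B"
    by (metis enn2ereal_ennreal less_eq_ennreal.rep_eq)
  \<comment> \<open>The cube \<open>[0, r]^d\<close> has the origin as a corner, and
    \<open>tent\<close> is at least \<open>1 - r\<close> on it.\<close>
  have Mo_r: "ereal (1 - r) \<le> enn2ereal (?M o1)" if r: "0 < r" "r < 1" for r
  proof -
    have "ennreal (1 - r) = (\<integral>\<^sup>+u. ennreal (1 - r) \<partial>unit_cube d)"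
      by (simp add: prob_unit_cube)
    also have "\<dots> \<le> (\<integral>\<^sup>+u. ennreal \<bar>tent d (cube_map d (\<lambda>_. 0) r u)\<bar> \<partial>unit_cube d)"
    proof (rule nn_integral_mono_AE)
      show "AE u in unit_cube d. ennreal (1 - r) \<le> ennreal \<bar>tent d (cube_map d (\<lambda>_. 0) r u)\<bar>"
        using AE_unit_cube
      proof eventually_elim
        case (elim u)
        then have "norm_inf d (cube_map d (\<lambda>_. 0) r u) \<le> r"
          unfolding norm_inf_le_iff[OF d] using r by (auto simp: cube_map_def abs_mult mult_left_le)
        then show ?case by (intro ennreal_leI) (simp add: tent_def)
      qed
    qed
    also have "\<dots> \<le> ?M o1"
      using r by (intro average_le_maximal d meas) (auto simp: cube_def o1_def PiE_iff extensional_def)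
    finally show ?thesis
      using r by (metis enn2ereal_ennreal less_eq_ennreal.rep_eq diff_ge_0_iff_ge less_imp_le)
  qed
  have Mo: "1 \<le> enn2ereal (?M o1)"
  proof (rule ereal_le_epsilon2)
    fix e :: real assume "0 < e"
    then have "1 \<le> ereal (1 - min e (1 / 2)) + ereal e"
      by (simp add: one_ereal_def)
    also have "\<dots> \<le> enn2ereal (?M o1) + ereal e"
      using \<open>0 < e\<close> by (intro add_right_mono Mo_r) auto
    finally show "1 \<le> enn2ereal (?M o1) + ereal e" .
  qed
  have "ereal (1 - ?B) \<le> enn2ereal (?M o1) - enn2ereal (?M e1)"
    using ereal_minus_mono[OF Mo Me] by (simp add: one_ereal_def)
  also have "\<dots> \<le> Lip d (\<lambda>x. enn2ereal (?M x))"
  proof -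
    \<comment> \<open>This makes the two values of the maximal function differ, so the quotient in
      \<open>Lip\<close> is governed by their difference and not by the special case of equal
      values.\<close>
    have "2 - (2 / 3 :: real) ^ d / 2 < real d + 1"
      using d zero_less_power[of "2 / 3 :: real" d] by linarith
    then have "?B < 1" by simp
    then have "ereal ?B < 1" by simp
    with Mo Me have "enn2ereal (?M e1) < enn2ereal (?M o1)"
      by (meson le_less_trans less_le_trans)
    then have "enn2ereal (?M o1) \<noteq> enn2ereal (?M e1)" by simp
    then have "\<bar>enn2ereal (?M o1) - enn2ereal (?M e1)\<bar> \<le> Lip d (\<lambda>x. enn2ereal (?M x))"
      using le_Lip[OF pts ne, of "\<lambda>x. enn2ereal (?M x)"] dist by (simp flip: one_ereal_def)
    then show ?thesis
      by (rule order_trans[rotated]) (cases "enn2ereal (?M o1) - enn2ereal (?M e1)"; simp)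
  qed
  also have "\<dots> = Lip d (\<lambda>x. enn2ereal (?M x)) / Lip d ?f"
    by (simp add: Lip)
  also have "\<dots> \<le> op_norm_Lip d"
    unfolding op_norm_Lip_def by (rule SUP_upper) (simp add: Lip)
  finally show ?thesis .
qed

text \<open>The left side is \<open>1 - 2 / (real d + 1)\<close>; strictness comes from the positive
  term \<open>(2 / 3) ^ d / 2\<close>.\<close>

lemma op_norm_Lip_gt:
  assumes d: "d \<ge> 1"
  shows "ereal ((real d - 1) / (real d + 1)) < op_norm_Lip d"
proof -
  have "(real d - 1) / (real d + 1) = 1 - 2 / (real d + 1)"
    by (simp add: field_simps)
  also have "\<dots> < 1 - (2 - (2 / 3) ^ d / 2) / (real d + 1)"
    by (intro diff_strict_left_mono divide_strict_right_mono) auto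
  finally show ?thesis
    using op_norm_Lip_ge[OF d] by (meson ereal_less_eq(3) less_ereal.simps(1) less_le_trans)
qed

section \<open>The explicit bound and the asymptotics\<close>

lemma tent_mass_explicit:
  assumes "s \<ge> 1"
  shows "1 - tent_mass d (1 - 1 / s) =
      real d / (real d + 1) - 1 / (real d + 1) * (1 - 1 / s) * (1 - (1 - 1 / (2 * s - 1)) ^ d)"
proof -
  have q: "2 * (1 - 1 / s) / (1 + (1 - 1 / s)) = 1 - 1 / (2 * s - 1)"
    using assms by (simp add: field_simps)
  have "real d / (real d + 1) = 1 - 1 / (real d + 1)" by (simp add: field_simps)
  then show ?thesis
    unfolding tent_mass_def q by (simp only: diff_divide_distrib add_divide_distrib right_diff_distrib left_diff_distrib)
      (simp add: mult.commute)
qed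

text \<open>With \<open>\<alpha> = 1 - 1 / sqrt d\<close>, \<alpha> tends to 1 slowly enough that
  the power \<open>(2 * \<alpha> / (1 + \<alpha>)) ^ d\<close>, roughly
  \<open>exp (- sqrt d / 2)\<close>, still tends to 0.\<close>

lemma op_norm_Lip_le_explicit:
  assumes d: "d \<ge> 1"
  shows "op_norm_Lip d \<le> ereal (real d / (real d + 1) - 1 / (real d + 1) * (1 - 1 / sqrt (real d))
           * (1 - (1 - 1 / (2 * sqrt (real d) - 1)) ^ d))"
proof -
  have s: "sqrt (real d) \<ge> 1" using d by simp
  have "op_norm_Lip d \<le> ereal (1 - tent_mass d (1 - 1 / sqrt (real d)))"
    by (rule op_norm_Lip_le[OF d]) (use s in auto)
  then show ?thesis
    by (simp only: tent_mass_explicit[OF s])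
qed

theorem corollary3p4:
  "(\<lambda>d::nat. real_of_ereal (op_norm_Lip d) - (real d - 1) / (real d + 1))
       \<in> o(\<lambda>d. 1 / (real d + 1))
   \<and> (\<forall>d::nat. d \<ge> 1 \<longrightarrow>
       ereal ((real d - 1) / (real d + 1)) < op_norm_Lip d \<and>
       op_norm_Lip d \<le> ereal (real d / (real d + 1)
         - 1 / (real d + 1) * (1 - 1 / sqrt (real d))
           * (1 - (1 - 1 / (2 * sqrt (real d) - 1)) ^ d)))"
proof (intro conjI allI impI)
  \<comment> \<open>This is \<open>d + 1\<close> times the gap between the explicit upper bound and
    \<open>(d - 1) / (d + 1)\<close>. It tends to 0 because both factors of the product tend to
    1.\<close>
  define g where "g d = 1 - (1 - 1 / sqrt (real d)) * (1 - (1 - 1 / (2 * sqrt (real d) - 1)) ^ d)" for d :: nat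
  have "g \<longlonglongrightarrow> 0"
    unfolding g_def by real_asymp
  show "(\<lambda>d. real_of_ereal (op_norm_Lip d) - (real d - 1) / (real d + 1)) \<in> o(\<lambda>d. 1 / (real d + 1))"
  proof (rule smalloI_tendsto)
    show "(\<lambda>d. (real_of_ereal (op_norm_Lip d) - (real d - 1) / (real d + 1)) / (1 / (real d + 1))) \<longlonglongrightarrow> 0"
    proof (rule tendsto_sandwich[OF _ _ tendsto_const \<open>g \<longlonglongrightarrow> 0\<close>])
      have *: "0 \<le> (real_of_ereal (op_norm_Lip d) - (real d - 1) / (real d + 1)) / (1 / (real d + 1)) \<and>
          (real_of_ereal (op_norm_Lip d) - (real d - 1) / (real d + 1)) / (1 / (real d + 1)) \<le> g d"
        if d: "d \<ge> 1" for d
      proof -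
        \<comment> \<open>The two real bounds make the operator norm finite, so
          \<open>real_of_ereal\<close> returns its true value.\<close>
        obtain r where r: "op_norm_Lip d = ereal r"
          using op_norm_Lip_gt[OF d] op_norm_Lip_le_explicit[OF d] by (cases "op_norm_Lip d") auto
        have "(real d - 1) / (real d + 1) < r"
          using op_norm_Lip_gt[OF d] r by simp
        moreover have "r \<le> (real d - 1) / (real d + 1) + g d / (real d + 1)"
        proof -
          have "real d / (real d + 1) - 1 / (real d + 1) * A * B =
              (real d - 1) / (real d + 1) + (1 - A * B) / (real d + 1)" for A B
            by (simp add: field_simps)
          then show ?thesis
            using op_norm_Lip_le_explicit[OF d] r unfolding g_def by (simp only: ereal_less_eq)
        qed
        then have "r - (real d - 1) / (real d + 1) \<le> g d / (real d + 1)"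
          by simp
        then have "(r - (real d - 1) / (real d + 1)) * (real d + 1) \<le> g d"
          by (subst (asm) pos_le_divide_eq) auto
        ultimately show ?thesis
          using r by simp
      qed
      show "\<forall>\<^sub>F d in sequentially. 0 \<le> (real_of_ereal (op_norm_Lip d) - (real d - 1) / (real d + 1)) / (1 / (real d + 1))"
        using * by (intro eventually_sequentiallyI[of 1]) blast
      show "\<forall>\<^sub>F d in sequentially. (real_of_ereal (op_norm_Lip d) - (real d - 1) / (real d + 1)) / (1 / (real d + 1)) \<le> g d"
        using * by (intro eventually_sequentiallyI[of 1]) blast
    qed
  qed (auto intro!: always_eventually)
qed (use op_norm_Lip_gt op_norm_Lip_le_explicit in auto)

end
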